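(* Let $G$ be a $6$-regular $(4,1)$-graph, let $A$ be a shore of a nontrivial $6$-edge-cut of $G$, let $H=G[A]$, and for $v\in A$ let $b(v)=6-d_H(v)$ and let $N_A(v)=N_G(v)\cap A$. Then for every $v\in A$ there exists a proper $3$-colouring $\psi: A\setminus\{v\}\to\{1,2,3\}$ of $H-v$ with \[ \sum_{i=1}^{3}\max\bigl(0,\,2-c_i(\psi)\bigr)\ \le\ b(v), \] where $c_i(\psi)=|\{u\in N_A(v):\psi(u)=i\}|$.
   Context: All graphs are finite and simple. A $(4,1)$-graph is a graph $G$ with $\chi(G)=4$, $\chi(G-v)=3$ for every vertex $v$, and $\chi(G-e)=4$ for every edge $e$. For a partition $V(G)=A\sqcup B$ with $A,B$ nonempty, the edge cut is the set $E(A,B)$ of edges with one end in $A$ and one in $B$; it is a $6$-edge-cut if $|E(A,B)|=6$, and $A$ and $B$ are its shores. A $6$-edge-cut is trivial if it is the set of all edges incident to a single vertex, and nontrivial otherwise (so both shores have at least two vertices). *)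

theory Defs
  imports Main "HOL-Library.FuncSet"
begin

record 'a ugraph =
  verts :: "'a set"
  edges :: "'a set set"

definition fin_simple_graph :: "'a ugraph \<Rightarrow> bool" where
  "fin_simple_graph G \<longleftrightarrow>
     finite (verts G) \<and> (\<forall>e \<in> edges G. e \<subseteq> verts G \<and> card e = 2)"

definition incident_edges :: "'a ugraph \<Rightarrow> 'a \<Rightarrow> 'a set set" where
  "incident_edges G v = {e \<in> edges G. v \<in> e}"

definition degree :: "'a ugraph \<Rightarrow> 'a \<Rightarrow> nat" where
  "degree G v = card (incident_edges G v)"

definition neighbours :: "'a ugraph \<Rightarrow> 'a \<Rightarrow> 'a set" where
  "neighbours G v = {u \<in> verts G. {u, v} \<in> edges G}"

definition regular :: "nat \<Rightarrow> 'a ugraph \<Rightarrow> bool" where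
  "regular k G \<longleftrightarrow> (\<forall>v \<in> verts G. degree G v = k)"

definition delete_vertex :: "'a ugraph \<Rightarrow> 'a \<Rightarrow> 'a ugraph" where
  "delete_vertex G v = \<lparr>verts = verts G - {v}, edges = edges G - incident_edges G v\<rparr>"

definition delete_edge :: "'a ugraph \<Rightarrow> 'a set \<Rightarrow> 'a ugraph" where
  "delete_edge G e = \<lparr>verts = verts G, edges = edges G - {e}\<rparr>"

definition induced_subgraph :: "'a ugraph \<Rightarrow> 'a set \<Rightarrow> 'a ugraph" where
  "induced_subgraph G A = \<lparr>verts = A, edges = {e \<in> edges G. e \<subseteq> A}\<rparr>"

text \<open>The values of a colouring outside the vertex set are unconstrained.\<close>

definition proper_colouring :: "'a ugraph \<Rightarrow> nat \<Rightarrow> ('a \<Rightarrow> nat) \<Rightarrow> bool" where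
  "proper_colouring G k \<psi> \<longleftrightarrow>
     \<psi> \<in> verts G \<rightarrow> {1..k} \<and> (\<forall>u w. {u, w} \<in> edges G \<longrightarrow> \<psi> u \<noteq> \<psi> w)"

definition chromatic_number :: "'a ugraph \<Rightarrow> nat" where
  "chromatic_number G = (LEAST k. \<exists>\<psi>. proper_colouring G k \<psi>)"

definition four_one_graph :: "'a ugraph \<Rightarrow> bool" where
  "four_one_graph G \<longleftrightarrow>
     fin_simple_graph G \<and>
     chromatic_number G = 4 \<and>
     (\<forall>v \<in> verts G. chromatic_number (delete_vertex G v) = 3) \<and>
     (\<forall>e \<in> edges G. chromatic_number (delete_edge G e) = 4)"

definition shores :: "'a ugraph \<Rightarrow> 'a set \<Rightarrow> 'a set \<Rightarrow> bool" where
  "shores G A B \<longleftrightarrow> A \<union> B = verts G \<and> A \<inter> B = {} \<and> A \<noteq> {} \<and> B \<noteq> {}"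

definition edge_cut :: "'a ugraph \<Rightarrow> 'a set \<Rightarrow> 'a set \<Rightarrow> 'a set set" where
  "edge_cut G A B = {e \<in> edges G. \<exists>a \<in> A. \<exists>b \<in> B. e = {a, b}}"

definition trivial_cut :: "'a ugraph \<Rightarrow> 'a set set \<Rightarrow> bool" where
  "trivial_cut G F \<longleftrightarrow> (\<exists>x \<in> verts G. F = incident_edges G x)"

definition nontrivial_6_edge_cut :: "'a ugraph \<Rightarrow> 'a set \<Rightarrow> 'a set \<Rightarrow> bool" where
  "nontrivial_6_edge_cut G A B \<longleftrightarrow>
     shores G A B \<and> card (edge_cut G A B) = 6 \<and> \<not> trivial_cut G (edge_cut G A B)"

end

theory Submission
  imports Defs
begin

text \<open>
  Colour \<open>G - v\<close> with three colours and restrict the colouring to \<open>A\<close>. Every colour \<open>i\<close> occurs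
  at least twice on the neighbourhood of \<open>v\<close> in \<open>G\<close>: otherwise some edge \<open>e\<close> at \<open>v\<close> meets
  every neighbour coloured \<open>i\<close>, so giving \<open>v\<close> the colour \<open>i\<close> colours \<open>G - e\<close> with three colours,
  whereas \<open>\<chi>(G - e) = 4\<close> (lemma \<open>colour_twice_at_deleted_vertex\<close>). Hence if only \<open>c\<^sub>i\<close>
  neighbours coloured \<open>i\<close> lie in \<open>A\<close>, the deficit \<open>2 - c\<^sub>i\<close> is made up by neighbours
  coloured \<open>i\<close> outside \<open>A\<close>. Distinct colours use distinct neighbours, so the total
  deficit is at most the number of neighbours of \<open>v\<close> outside \<open>A\<close>
  (lemma \<open>sum_colour_deficits_le\<close>), and by \<open>6\<close>-regularity this number is \<open>b(v)\<close>.
\<close>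

lemma edge_not_loop:
  assumes "fin_simple_graph G" "{u, w} \<in> edges G"
  shows "u \<noteq> w"
proof -
  have "card {u, w} = 2"
    using assms unfolding fin_simple_graph_def by blast
  then show ?thesis
    by auto
qed

lemma neighbours_iff_edge:
  assumes "fin_simple_graph G"
  shows "u \<in> neighbours G v \<longleftrightarrow> {u, v} \<in> edges G"
  using assms by (auto simp: fin_simple_graph_def neighbours_def)

lemma finite_neighbours:
  assumes "fin_simple_graph G"
  shows "finite (neighbours G v)"
  using assms by (simp add: fin_simple_graph_def neighbours_def)

lemma degree_eq_card_neighbours:
  assumes "fin_simple_graph G"
  shows "degree G v = card (neighbours G v)"
proof -
  have "incident_edges G v = (\<lambda>u. {u, v}) ` neighbours G v"
  proof (intro subset_antisym subsetI)
    fix e assume e: "e \<in> incident_edges G v"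
    then have "card e = 2" "e \<in> edges G" "v \<in> e"
      using assms by (auto simp: fin_simple_graph_def incident_edges_def)
    then obtain u where "e = {u, v}"
      by (auto simp: card_2_iff)
    then show "e \<in> (\<lambda>u. {u, v}) ` neighbours G v"
      using \<open>e \<in> edges G\<close> neighbours_iff_edge[OF assms] by blast
  qed (auto simp: incident_edges_def neighbours_def)
  moreover have "inj_on (\<lambda>u. {u, v}) (neighbours G v)"
    by (auto simp: inj_on_def doubleton_eq_iff)
  ultimately show ?thesis
    by (simp add: degree_def card_image)
qed

lemma fin_simple_graph_delete_vertex:
  "fin_simple_graph G \<Longrightarrow> fin_simple_graph (delete_vertex G v)"
  by (auto simp: fin_simple_graph_def delete_vertex_def incident_edges_def)

lemma fin_simple_graph_induced_subgraph:
  "fin_simple_graph G \<Longrightarrow> A \<subseteq> verts G \<Longrightarrow> fin_simple_graph (induced_subgraph G A)"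
  by (auto simp: fin_simple_graph_def induced_subgraph_def intro: finite_subset)

lemma neighbours_induced_subgraph:
  "A \<subseteq> verts G \<Longrightarrow> v \<in> A \<Longrightarrow> neighbours (induced_subgraph G A) v = neighbours G v \<inter> A"
  by (auto simp: neighbours_def induced_subgraph_def)

text \<open>
  The chromatic number is a least element, so it is attained as soon as some colouring exists;
  for a finite simple graph, colouring all vertices differently is one.
\<close>

lemma proper_colouring_chromatic_number:
  assumes "fin_simple_graph G"
  shows "\<exists>\<psi>. proper_colouring G (chromatic_number G) \<psi>"
proof -
  have "finite (verts G)"
    using assms by (simp add: fin_simple_graph_def)
  then obtain f where "bij_betw f (verts G) {1..card (verts G)}"
    using finite_same_card_bij[of "verts G" "{1..card (verts G)}"] by auto
  then have f: "f \<in> verts G \<rightarrow> {1..card (verts G)}" "inj_on f (verts G)"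
    by (auto simp: bij_betw_def)
  have "f u \<noteq> f w" if "{u, w} \<in> edges G" for u w
  proof -
    have "u \<in> verts G" "w \<in> verts G"
      using assms that by (auto simp: fin_simple_graph_def)
    then show ?thesis
      using f(2) edge_not_loop[OF assms that] by (auto dest: inj_onD)
  qed
  then have "proper_colouring G (card (verts G)) f"
    using f(1) by (simp add: proper_colouring_def)
  then show ?thesis
    unfolding chromatic_number_def by (rule LeastI[where P = "\<lambda>k. \<exists>\<psi>. proper_colouring G k \<psi>", OF exI])
qed

lemma chromatic_number_le:
  "proper_colouring G k \<psi> \<Longrightarrow> chromatic_number G \<le> k"
  unfolding chromatic_number_def by (rule Least_le) blast

lemma proper_colouring_extend_to_deleted_vertex:
  assumes G: "fin_simple_graph G"
    and \<psi>: "proper_colouring (delete_vertex G v) k \<psi>"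
    and i: "i \<in> {1..k}"
    and unique: "{u \<in> neighbours G v. \<psi> u = i} \<subseteq> {w}"
  shows "proper_colouring (delete_edge G {w, v}) k (\<psi>(v := i))"
proof -
  have away: "\<psi> x \<noteq> \<psi> y" if "{x, y} \<in> edges G" "x \<noteq> v" "y \<noteq> v" for x y
    using \<psi> that by (auto simp: proper_colouring_def delete_vertex_def incident_edges_def)
  have at_v: "\<psi> x \<noteq> i" if "{x, v} \<in> edges G" "x \<noteq> w" for x
    using unique that neighbours_iff_edge[OF G] by blast
  have "(\<psi>(v := i)) x \<noteq> (\<psi>(v := i)) y" if "{x, y} \<in> edges G" "{x, y} \<noteq> {w, v}" for x y
  proof -
    have "x \<noteq> y"
      using edge_not_loop[OF G that(1)] .
    then consider "x = v" "y \<noteq> v" | "y = v" "x \<noteq> v" | "x \<noteq> v" "y \<noteq> v"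
      by blast
    then show ?thesis
    proof cases
      case 1
      then show ?thesis
        using at_v[of y] that by (auto simp: insert_commute)
    next
      case 2
      then show ?thesis
        using at_v[of x] that by auto
    next
      case 3
      then show ?thesis
        using away that by auto
    qed
  qed
  moreover have "\<psi>(v := i) \<in> verts G \<rightarrow> {1..k}"
    using \<psi> i by (auto simp: proper_colouring_def delete_vertex_def)
  ultimately show ?thesis
    by (auto simp: proper_colouring_def delete_edge_def)
qed

text \<open>
  A colour seen at most once at \<open>v\<close> could be given to \<open>v\<close> itself after deleting a single edge.
  A neighbour of \<open>v\<close> must exist so that there is an edge to delete even if the colour is not
  seen at all.
\<close>

lemma colour_twice_at_deleted_vertex:
  assumes G: "fin_simple_graph G"
    and critical: "\<And>e. e \<in> edges G \<Longrightarrow> k < chromatic_number (delete_edge G e)"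
    and \<psi>: "proper_colouring (delete_vertex G v) k \<psi>"
    and nonempty: "neighbours G v \<noteq> {}"
    and i: "i \<in> {1..k}"
  shows "2 \<le> card {u \<in> neighbours G v. \<psi> u = i}" (is "2 \<le> card ?S")
proof (rule ccontr)
  assume "\<not> 2 \<le> card ?S"
  then have "card ?S = 0 \<or> card ?S = 1"
    by linarith
  moreover have "finite ?S"
    using finite_neighbours[OF G] by simp
  ultimately have "?S = {} \<or> (\<exists>w. ?S = {w})"
    by (metis card_0_eq card_1_singletonE)
  then obtain w where w: "w \<in> neighbours G v" "?S \<subseteq> {w}"
    using nonempty by blast
  have "chromatic_number (delete_edge G {w, v}) \<le> k"
    using proper_colouring_extend_to_deleted_vertex[OF G \<psi> i w(2)] by (rule chromatic_number_le)
  moreover have "{w, v} \<in> edges G"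
    using w(1) by (simp add: neighbours_def)
  ultimately show False
    using critical by force
qed

lemma card_eq_sum_colour_classes:
  assumes "finite X" "\<psi> \<in> X \<rightarrow> C" "finite C"
  shows "card X = (\<Sum>i\<in>C. card {u \<in> X. \<psi> u = i})"
proof -
  have "\<psi> ` X \<subseteq> C"
    using assms(2) by blast
  from sum.group[OF assms(1,3) this, of "\<lambda>_. 1::nat"] show ?thesis
    by simp
qed

text \<open>
  If every colour occurs twice on \<open>X\<close>, what a colour lacks on \<open>X \<inter> A\<close> is supplied by
  elements of \<open>X - A\<close>.
\<close>

lemma sum_colour_deficits_le:
  assumes X: "finite X" and \<psi>: "\<psi> \<in> X \<rightarrow> C" and C: "finite C"
    and twice: "\<And>i. i \<in> C \<Longrightarrow> 2 \<le> card {u \<in> X. \<psi> u = i}"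
  shows "(\<Sum>i\<in>C. max 0 (2 - int (card {u \<in> X \<inter> A. \<psi> u = i}))) \<le> int (card X) - int (card (X \<inter> A))"
proof -
  have "(\<Sum>i\<in>C. max 0 (2 - int (card {u \<in> X \<inter> A. \<psi> u = i})))
      \<le> (\<Sum>i\<in>C. int (card {u \<in> X. \<psi> u = i}) - int (card {u \<in> X \<inter> A. \<psi> u = i}))"
  proof (rule sum_mono)
    fix i assume "i \<in> C"
    moreover have "card {u \<in> X \<inter> A. \<psi> u = i} \<le> card {u \<in> X. \<psi> u = i}"
      using X by (intro card_mono) auto
    ultimately show "max 0 (2 - int (card {u \<in> X \<inter> A. \<psi> u = i}))
        \<le> int (card {u \<in> X. \<psi> u = i}) - int (card {u \<in> X \<inter> A. \<psi> u = i})"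
      using twice by force
  qed
  also have "\<dots> = int (card X) - int (card (X \<inter> A))"
  proof -
    have "\<psi> \<in> X \<inter> A \<rightarrow> C"
      using \<psi> by blast
    then show ?thesis
      using card_eq_sum_colour_classes[OF X \<psi> C]
        card_eq_sum_colour_classes[of "X \<inter> A" \<psi> C] X C
      by (simp add: sum_subtractf flip: of_nat_sum)
  qed
  finally show ?thesis .
qed

lemma proper_colouring_delete_vertex_induced_subgraph:
  assumes "proper_colouring (delete_vertex G v) k \<psi>" "A \<subseteq> verts G"
  shows "proper_colouring (delete_vertex (induced_subgraph G A) v) k \<psi>"
  using assms
  by (auto simp: proper_colouring_def delete_vertex_def induced_subgraph_def incident_edges_def)

theorem lemma4p2:
  fixes G H :: "'a ugraph" and A B :: "'a set" and b :: "'a \<Rightarrow> int"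
    and N\<^sub>A :: "'a \<Rightarrow> 'a set" and v :: 'a
  assumes "four_one_graph G"
    and "regular 6 G"
    and "nontrivial_6_edge_cut G A B"
    and "H = induced_subgraph G A"
    and "\<And>u. u \<in> A \<Longrightarrow> b u = 6 - int (degree H u)"
    and "\<And>u. u \<in> A \<Longrightarrow> N\<^sub>A u = neighbours G u \<inter> A"
    and "v \<in> A"
  shows "\<exists>\<psi>. proper_colouring (delete_vertex H v) 3 \<psi> \<and>
           (\<Sum>i = 1..(3::nat). max 0 (2 - int (card {u \<in> N\<^sub>A v. \<psi> u = i}))) \<le> b v"
proof -
  have G: "fin_simple_graph G"
    and vertex_critical: "\<And>u. u \<in> verts G \<Longrightarrow> chromatic_number (delete_vertex G u) = 3"
    and edge_deleted: "\<And>e. e \<in> edges G \<Longrightarrow> 3 < chromatic_number (delete_edge G e)"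
    using assms(1) by (auto simp: four_one_graph_def)
  have A: "A \<subseteq> verts G"
    using assms(3) by (auto simp: nontrivial_6_edge_cut_def shores_def)
  with assms(7) have v: "v \<in> verts G"
    by blast
  have six: "card (neighbours G v) = 6"
    using assms(2) v degree_eq_card_neighbours[OF G] by (simp add: regular_def)
  then have nonempty: "neighbours G v \<noteq> {}"
    by auto
  have b: "b v = 6 - int (card (neighbours G v \<inter> A))"
    using assms(4,5,7) A degree_eq_card_neighbours[OF fin_simple_graph_induced_subgraph[OF G A]]
    by (simp add: neighbours_induced_subgraph)
  obtain \<psi> where \<psi>: "proper_colouring (delete_vertex G v) 3 \<psi>"
    using proper_colouring_chromatic_number[OF fin_simple_graph_delete_vertex[OF G]]
      vertex_critical[OF v] by metis
  have "\<psi> \<in> neighbours G v \<rightarrow> {1..3}"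
  proof
    fix u assume "u \<in> neighbours G v"
    then have "u \<in> verts G" "u \<noteq> v"
      using edge_not_loop[OF G] by (simp_all add: neighbours_def)
    then show "\<psi> u \<in> {1..3}"
      using \<psi> by (auto simp: proper_colouring_def delete_vertex_def)
  qed
  then have "(\<Sum>i = 1..(3::nat). max 0 (2 - int (card {u \<in> neighbours G v \<inter> A. \<psi> u = i})))
      \<le> int (card (neighbours G v)) - int (card (neighbours G v \<inter> A))"
    using finite_neighbours[OF G] colour_twice_at_deleted_vertex[OF G edge_deleted \<psi> nonempty]
    by (intro sum_colour_deficits_le) auto
  then show ?thesis
    using proper_colouring_delete_vertex_induced_subgraph[OF \<psi> A] six b assms(4,6,7) by auto
qed

end
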